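(* There exist sufficiently small absolute constants $c_1,c_2>0$ such that the following holds. Let $n\ge 2$ be an integer and let $\epsilon,\varphi\ge 0$ satisfy $\frac{\epsilon}{\varphi^2}\log(1/\epsilon)\le c_1$ and $\log(1/\epsilon)\log(\varphi^2/\epsilon)\le c_2\log n$ (so in particular $\epsilon,\varphi>0$). Then for every $t\ge 20\frac{\log n}{\varphi^2}$ there exists a polynomial $p$ of the form $p(x)=x^t q(x)$, where $q$ is a polynomial of degree $O(\epsilon t+\log(\varphi^2/\epsilon))$, such that all coefficients of $p$ are bounded in absolute value by $(1/\epsilon)^{O(\epsilon t+\log(\varphi^2/\epsilon))}$ and \begin{itemize} \item $|p(x)-1|\le \epsilon/\varphi^2$ for all $x\in[1-\epsilon,1]$, \item $|p(x)|\le n^{-4}$ for all $x\in[0,1-\varphi^2/4]$. \end{itemize}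
   Context: The constants implicit in the $O(\cdot)$ notation are absolute.
   Formalization: The formal statement adds ε ≤ 1/2; without it the claim fails: for φ = 1 and ε = 1−δ with δ small, both smallness conditions hold, but the bullets at x = 1/2 force δ ≤ p(1/2) ≤ n^{-4}, false for large n. *)

theory Defs
  imports Complex_Main "HOL-Computational_Algebra.Polynomial"
begin

text \<open>
  All logarithms are natural. In the two smallness hypotheses and in the \<open>O\<close>-terms the base only
  affects absolute constants; in \<open>t \<ge> 20 log n / \<phi>\<^sup>2\<close> the natural logarithm gives the larger range
  of \<open>t\<close> compared with base 2. Since \<open>x\<^sup>t q(x)\<close> is a polynomial, \<open>t\<close> is a natural number.

  Positivity of \<open>\<epsilon>\<close> and \<open>\<phi>\<close>, which the hypotheses imply when \<open>log (1/0)\<close> is read as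
  infinite, has to be assumed, because \<open>ln (1/0) = 0\<close> and \<open>x / 0 = 0\<close> in HOL.

  The hypothesis \<open>\<epsilon> \<le> 1/2\<close> makes explicit that \<open>log (1/\<epsilon>)\<close> is bounded away from 0, so that
  a small \<open>(\<epsilon>/\<phi>\<^sup>2) log (1/\<epsilon>)\<close> forces a small \<open>\<epsilon>/\<phi>\<^sup>2\<close>. Without it the claim fails:
  for \<open>\<phi> = 1\<close> and \<open>\<epsilon> = 1 - \<delta>\<close> with \<open>\<delta> > 0\<close> small, both smallness hypotheses hold for all
  \<open>n \<ge> 2\<close>, but the two bounds at \<open>x = 1/2\<close> require \<open>\<delta> \<le> p(1/2) \<le> 1/n\<^sup>4\<close>, which is false
  for large \<open>n\<close>.
\<close>

end

theory Submission
  imports Defs "HOL-Analysis.Generalised_Binomial_Theorem" "HOL-Analysis.Harmonic_Numbers"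
begin

text \<open>
  With \<open>R = ln (\<phi>\<^sup>2/\<epsilon>)\<close>, let \<open>q\<close> be the Taylor polynomial of \<open>x\<^sup>-\<^sup>t\<close> at \<open>x = 1\<close> of degree
  \<open>d \<approx> 6 (\<epsilon> t + R)\<close>. For \<open>y = 1 - x\<close> the number \<open>1 - x\<^sup>t q(x)\<close> is the probability that a negative
  binomial variable with parameters \<open>t, y\<close> exceeds \<open>d\<close>, which a Chernoff bound controls for
  \<open>y \<le> \<epsilon>\<close>. The Taylor coefficients up to \<open>d\<close> sum to at most \<open>\<epsilon>\<^sup>-\<^sup>d (1 - \<epsilon>)\<^sup>-\<^sup>t\<close>, and this bounds the
  coefficients of \<open>p\<close>. Away from \<open>1\<close> the factor \<open>x\<^sup>t \<le> exp (-\<phi>\<^sup>2 t/4) \<le> n\<^sup>-\<^sup>4 exp (-\<phi>\<^sup>2 t/20)\<close>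
  absorbs this sum.
\<close>

section \<open>Negative binomial weights and their tails\<close>

definition negbin_coeff :: "nat \<Rightarrow> nat \<Rightarrow> real" where
  "negbin_coeff t k = pochhammer (real t) k / fact k"

lemma negbin_coeff_nonneg: "negbin_coeff t k \<ge> 0"
  unfolding negbin_coeff_def pochhammer_prod
  by (intro divide_nonneg_nonneg prod_nonneg) auto

text \<open>This is the binomial series for exponent \<open>-t\<close>: the sign in
  \<open>(-t) gchoose k\<close> cancels against that of \<open>(-y) ^ k\<close>. Hence the terms
  times \<open>(1 - y) ^ t\<close> are the negative binomial probabilities, also for
  \<open>t = 0\<close>, where only \<open>k = 0\<close> survives.\<close>

lemma negbin_coeff_sums:
  fixes y :: real
  assumes "0 \<le> y" "y < 1"
  shows "(\<lambda>k. negbin_coeff t k * y ^ k) sums (1 / (1 - y) ^ t)"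
proof -
  have "(\<lambda>k. ((- real t) gchoose k) * (-y) ^ k) sums ((1 + (-y)) powr (- real t))"
    by (rule gen_binomial_real) (use assms in auto)
  moreover have "((- real t) gchoose k) * (-y) ^ k = negbin_coeff t k * y ^ k" for k
  proof -
    have "(-1) ^ k * (-y) ^ k = y ^ k" by (subst power_mult_distrib[symmetric]) simp
    thus ?thesis by (simp add: gbinomial_pochhammer negbin_coeff_def)
  qed
  moreover have "(1 + (-y)) powr (- real t) = 1 / (1 - y) ^ t"
    using assms by (simp add: powr_minus powr_realpow divide_inverse)
  ultimately show ?thesis by simp
qed

text \<open>For \<open>k \<le> d\<close> the factor \<open>w ^ k / w ^ d\<close> is at least 1;
  inserting it compares the sum with the full generating function at \<open>w\<close>. The parameter
  is left free and later set to \<open>\<epsilon>\<close>, so that the bound is essentially a power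
  of \<open>1 / \<epsilon>\<close>.\<close>

lemma sum_negbin_coeff_le:
  fixes w :: real
  assumes "0 < w" "w < 1"
  shows "(\<Sum>k\<le>d. negbin_coeff t k) \<le> (1 / w) ^ d * (1 / (1 - w) ^ t)"
proof -
  have "(\<Sum>k\<le>d. negbin_coeff t k) \<le> (\<Sum>k\<le>d. (1 / w) ^ d * (negbin_coeff t k * w ^ k))"
  proof (rule sum_mono)
    fix k assume "k \<in> {..d}"
    hence "w ^ d \<le> w ^ k" using assms by (intro power_decreasing) auto
    hence "1 \<le> (1 / w) ^ d * w ^ k" using assms by (simp add: power_divide field_simps)
    from mult_left_mono[OF this negbin_coeff_nonneg[of t k]]
    show "negbin_coeff t k \<le> (1 / w) ^ d * (negbin_coeff t k * w ^ k)"
      by (simp add: algebra_simps)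
  qed
  also have "\<dots> = (1 / w) ^ d * (\<Sum>k\<le>d. negbin_coeff t k * w ^ k)"
    by (simp add: sum_distrib_left)
  also have "(\<Sum>k\<le>d. negbin_coeff t k * w ^ k) \<le> 1 / (1 - w) ^ t"
  proof -
    have s: "(\<lambda>k. negbin_coeff t k * w ^ k) sums (1 / (1 - w) ^ t)"
      using assms by (intro negbin_coeff_sums) auto
    have "(\<Sum>k\<le>d. negbin_coeff t k * w ^ k) \<le> (\<Sum>k. negbin_coeff t k * w ^ k)"
      using s assms by (intro sum_le_suminf) (auto simp: sums_iff negbin_coeff_nonneg)
    thus ?thesis using s by (simp add: sums_iff)
  qed
  hence "(1 / w) ^ d * (\<Sum>k\<le>d. negbin_coeff t k * w ^ k) \<le> (1 / w) ^ d * (1 / (1 - w) ^ t)"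
    using assms by (intro mult_left_mono) auto
  finally show ?thesis .
qed

text \<open>Both bounds come from the omitted tail: it is nonnegative, and it is small by comparison
  with the series at \<open>3 / 2 * y\<close>. That series converges because
  \<open>y \<le> 1 / 2\<close> keeps its argument at most 3/4.\<close>

lemma negbin_tail_bounds:
  fixes y :: real and t d :: nat
  assumes "0 \<le> y" "y \<le> 1 / 2"
  defines "S \<equiv> (\<Sum>k\<le>d. negbin_coeff t k * y ^ k)"
  shows "(1 - y) ^ t * S \<le> 1" "1 - (1 - y) ^ t * S \<le> exp (2 * y * real t) * (2 / 3) ^ d"
proof -
  define a where "a = negbin_coeff t"
  have s: "(\<lambda>k. a k * y ^ k) sums (1 / (1 - y) ^ t)"
    unfolding a_def using assms by (intro negbin_coeff_sums) auto
  have z: "(\<lambda>k. a k * (3 / 2 * y) ^ k) sums (1 / (1 - 3 / 2 * y) ^ t)"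
    unfolding a_def using assms by (intro negbin_coeff_sums) auto
  have a0: "a k \<ge> 0" for k by (simp add: a_def negbin_coeff_nonneg)
  have S: "S = (\<Sum>k<Suc d. a k * y ^ k)" by (simp add: S_def a_def lessThan_Suc_atMost)
  define T where "T = (\<Sum>k. a (k + Suc d) * y ^ (k + Suc d))"
  have split: "1 / (1 - y) ^ t = T + S"
    using suminf_split_initial_segment[OF sums_summable[OF s], of "Suc d"] s
    unfolding T_def S by (simp only: sums_iff)
  have sT: "summable (\<lambda>k. a (k + Suc d) * y ^ (k + Suc d))"
    by (rule summable_ignore_initial_segment[OF sums_summable[OF s]])
  have sz: "summable (\<lambda>k. a (k + Suc d) * (3 / 2 * y) ^ (k + Suc d))"
    by (rule summable_ignore_initial_segment[OF sums_summable[OF z]])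
  have T0: "T \<ge> 0" unfolding T_def
    by (rule suminf_nonneg[OF sT]) (use a0 assms in auto)
  \<comment> \<open>exponential Markov inequality: each index beyond \<open>d\<close> gains a factor \<open>3/2\<close>\<close>
  have "T \<le> (\<Sum>k. (2 / 3) ^ d * (a (k + Suc d) * (3 / 2 * y) ^ (k + Suc d)))"
    unfolding T_def
  proof (rule suminf_le[OF _ sT summable_mult[OF sz]])
    fix k
    have "(1::real) = (2 / 3) ^ d * (3 / 2) ^ d" by (simp flip: power_mult_distrib)
    also have "\<dots> \<le> (2 / 3) ^ d * (3 / 2) ^ (k + Suc d)"
      by (intro mult_left_mono power_increasing) auto
    finally have "a (k + Suc d) * y ^ (k + Suc d) * 1
      \<le> a (k + Suc d) * y ^ (k + Suc d) * ((2 / 3) ^ d * (3 / 2) ^ (k + Suc d))"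
      using a0 assms by (intro mult_left_mono) auto
    thus "a (k + Suc d) * y ^ (k + Suc d)
      \<le> (2 / 3) ^ d * (a (k + Suc d) * (3 / 2 * y) ^ (k + Suc d))"
      by (simp only: power_mult_distrib mult_1_right mult_ac)
  qed
  also have "\<dots> = (2 / 3) ^ d * (\<Sum>k. a (k + Suc d) * (3 / 2 * y) ^ (k + Suc d))"
    by (rule suminf_mult[OF sz])
  also have "\<dots> \<le> (2 / 3) ^ d * (1 / (1 - 3 / 2 * y) ^ t)"
  proof (rule mult_left_mono)
    have "(\<Sum>k<Suc d. a k * (3 / 2 * y) ^ k) \<ge> 0"
      using a0 assms by (intro sum_nonneg) auto
    thus "(\<Sum>k. a (k + Suc d) * (3 / 2 * y) ^ (k + Suc d)) \<le> 1 / (1 - 3 / 2 * y) ^ t"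
      using suminf_split_initial_segment[OF sums_summable[OF z], of "Suc d"] sums_unique[OF z]
      by linarith
  qed auto
  finally have T: "T \<le> (2 / 3) ^ d * (1 / (1 - 3 / 2 * y) ^ t)" .
  have pos: "(1 - y) ^ t > 0" using assms by simp
  have eq: "1 - (1 - y) ^ t * S = (1 - y) ^ t * T"
  proof -
    have "(1 - y) ^ t * (T + S) = 1" using assms(1,2) by (simp flip: split)
    thus ?thesis by (simp add: distrib_left)
  qed
  show "(1 - y) ^ t * S \<le> 1" using eq T0 pos by (smt (verit) mult_nonneg_nonneg)
  \<comment> \<open>The next inequality amounts to \<open>3 / 2 * (y - 2 * y^2) \<ge> 0\<close>, for
    which \<open>y \<le> 1 / 2\<close> is exactly enough.\<close>
  have "y * (2 * y) \<le> y * 1" using assms by (intro mult_left_mono) auto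
  hence "1 - y \<le> (1 + 2 * y) * (1 - 3 / 2 * y)" by (simp add: algebra_simps)
  hence "(1 - y) / (1 - 3 / 2 * y) \<le> 1 + 2 * y"
    using assms by (simp add: pos_divide_le_eq)
  also have "\<dots> \<le> exp (2 * y)" by (rule exp_ge_add_one_self)
  finally have "((1 - y) / (1 - 3 / 2 * y)) ^ t \<le> exp (2 * y) ^ t"
    using assms by (intro power_mono) auto
  hence e: "((1 - y) / (1 - 3 / 2 * y)) ^ t \<le> exp (2 * y * real t)"
    by (simp add: exp_of_nat2_mult)
  have "(1 - y) ^ t * T \<le> (1 - y) ^ t * ((2 / 3) ^ d * (1 / (1 - 3 / 2 * y) ^ t))"
    using T pos by (intro mult_left_mono) auto
  also have "\<dots> = ((1 - y) / (1 - 3 / 2 * y)) ^ t * (2 / 3) ^ d"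
    by (simp add: power_divide)
  also have "\<dots> \<le> exp (2 * y * real t) * (2 / 3) ^ d"
    using e by (intro mult_right_mono) auto
  finally show "1 - (1 - y) ^ t * S \<le> exp (2 * y * real t) * (2 / 3) ^ d"
    using eq by simp
qed

section \<open>The truncated series as a polynomial in \<open>1 - x\<close>\<close>

lemma abs_coeff_one_minus_X_power_le: "\<bar>coeff ([:1, -1::real:] ^ k) i\<bar> \<le> 2 ^ k"
proof (induction k arbitrary: i)
  case 0
  show ?case by (simp add: coeff_1)
next
  case (Suc k)
  have "coeff ([:1, -1::real:] ^ Suc k) i = coeff ([:1, -1:] ^ k) i
      - (case i of 0 \<Rightarrow> 0 | Suc j \<Rightarrow> coeff ([:1, -1:] ^ k) j)"
    by (simp add: coeff_pCons split: nat.split)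
  \<comment> \<open>Each factor \<open>1 - X\<close> at most doubles the largest coefficient. The
    index \<open>i - 1\<close> serves the case \<open>i = Suc j\<close>; for \<open>i = 0\<close>
    nothing is subtracted.\<close>
  thus ?case using Suc[of i] Suc[of "i - 1"] by (auto split: nat.splits)
qed

definition negbin_poly :: "nat \<Rightarrow> nat \<Rightarrow> real poly" where
  "negbin_poly t d = (\<Sum>k\<le>d. smult (negbin_coeff t k) ([:1, -1:] ^ k))"

lemma poly_negbin_poly: "poly (negbin_poly t d) x = (\<Sum>k\<le>d. negbin_coeff t k * (1 - x) ^ k)"
  by (simp add: negbin_poly_def poly_sum)

lemma degree_negbin_poly: "degree (negbin_poly t d) \<le> d"
  unfolding negbin_poly_def
proof (rule degree_sum_le)
  fix k assume "k \<in> {..d}"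
  have "degree (smult (negbin_coeff t k) ([:1, -1:] ^ k)) \<le> degree ([:1, -1::real:] ^ k)"
    by (rule degree_smult_le)
  also have "\<dots> \<le> degree [:1, -1::real:] * k" by (rule degree_power_le)
  finally show "degree (smult (negbin_coeff t k) ([:1, -1:] ^ k)) \<le> d"
    using \<open>k \<in> {..d}\<close> by simp
qed simp

text \<open>Passing from powers of \<open>1 - X\<close> to monomials costs at most
  \<open>2 ^ d\<close>. This is affordable, since \<open>2 \<le> 1 / \<epsilon>\<close> later
  absorbs it into \<open>(1 / \<epsilon>) ^ d\<close>.\<close>

lemma abs_coeff_negbin_poly_le:
  "\<bar>coeff (negbin_poly t d) i\<bar> \<le> 2 ^ d * (\<Sum>k\<le>d. negbin_coeff t k)"
proof -
  have "\<bar>coeff (negbin_poly t d) i\<bar> \<le> (\<Sum>k\<le>d. \<bar>negbin_coeff t k * coeff ([:1, -1:] ^ k) i\<bar>)"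
    unfolding negbin_poly_def by (simp add: coeff_sum sum_abs)
  also have "\<dots> \<le> (\<Sum>k\<le>d. 2 ^ d * negbin_coeff t k)"
  proof (rule sum_mono)
    fix k assume "k \<in> {..d}"
    hence "(2::real) ^ k \<le> 2 ^ d" by (intro power_increasing) auto
    hence "\<bar>coeff ([:1, -1::real:] ^ k) i\<bar> \<le> 2 ^ d"
      using abs_coeff_one_minus_X_power_le[of k i] by linarith
    from mult_left_mono[OF this negbin_coeff_nonneg[of t k]]
    show "\<bar>negbin_coeff t k * coeff ([:1, -1:] ^ k) i\<bar> \<le> 2 ^ d * negbin_coeff t k"
      by (simp add: abs_mult negbin_coeff_nonneg mult.commute)
  qed
  finally show ?thesis by (simp add: sum_distrib_left)
qed

lemma sum_negbin_coeff_le_exp: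
  fixes \<epsilon> :: real
  assumes "0 < \<epsilon>" "\<epsilon> \<le> 1 / 2"
  shows "(\<Sum>k\<le>d. negbin_coeff t k) \<le> exp (real d * ln (1 / \<epsilon>) + 2 * \<epsilon> * real t)"
proof -
  have "\<epsilon> * (2 * \<epsilon>) \<le> \<epsilon> * 1" using assms by (intro mult_left_mono) auto
  hence "1 / (1 - \<epsilon>) \<le> 1 + 2 * \<epsilon>" using assms by (simp add: pos_divide_le_eq algebra_simps)
  also have "\<dots> \<le> exp (2 * \<epsilon>)" by (rule exp_ge_add_one_self)
  finally have "(1 / (1 - \<epsilon>)) ^ t \<le> exp (2 * \<epsilon>) ^ t"
    using assms by (intro power_mono) auto
  hence e: "1 / (1 - \<epsilon>) ^ t \<le> exp (2 * \<epsilon> * real t)"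
    by (simp add: exp_of_nat2_mult power_divide)
  have "(\<Sum>k\<le>d. negbin_coeff t k) \<le> (1 / \<epsilon>) ^ d * (1 / (1 - \<epsilon>) ^ t)"
    using assms by (intro sum_negbin_coeff_le) auto
  also have "\<dots> \<le> (1 / \<epsilon>) ^ d * exp (2 * \<epsilon> * real t)"
    using e assms by (intro mult_left_mono) auto
  also have "(1 / \<epsilon>) ^ d = exp (real d * ln (1 / \<epsilon>))"
    using assms by (simp only: exp_of_nat_mult exp_ln zero_less_divide_iff zero_less_one simp_thms)
  finally show ?thesis by (simp add: exp_add)
qed

section \<open>Choice of the degree and the four estimates\<close>

lemma exists_approx_poly:
  fixes n t :: nat and \<epsilon> \<phi> :: real
  assumes n: "n \<ge> 2" and \<epsilon>: "0 < \<epsilon>" "\<epsilon> \<le> 1 / 2" and \<phi>: "0 < \<phi>"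
    and small1: "\<epsilon> / \<phi>^2 * ln (1/\<epsilon>) \<le> 1 / 200"
    and small2: "ln (1/\<epsilon>) * ln (\<phi>^2 / \<epsilon>) \<le> 1 / 200 * ln (real n)"
    and t: "real t \<ge> 20 * (ln (real n) / \<phi>^2)"
  shows "\<exists>p q :: real poly.
           p = monom 1 t * q \<and>
           real (degree q) \<le> 7 * (\<epsilon> * real t + ln (\<phi>^2 / \<epsilon>)) \<and>
           (\<forall>i. \<bar>coeff p i\<bar> \<le> (1/\<epsilon>) powr (17 * (\<epsilon> * real t + ln (\<phi>^2 / \<epsilon>)))) \<and>
           (\<forall>x\<in>{1 - \<epsilon>..1}. \<bar>poly p x - 1\<bar> \<le> \<epsilon> / \<phi>^2) \<and>
           (\<forall>x\<in>{0..1 - \<phi>^2 / 4}. \<bar>poly p x\<bar> \<le> real n powr (-4))"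
proof -
  define L where "L = ln (1 / \<epsilon>)"
  define R where "R = ln (\<phi>^2 / \<epsilon>)"
  \<comment> \<open>The factor 6 makes \<open>d / 3\<close> at least
    \<open>2 * \<epsilon> * t + 2 * R\<close>, which beats the growth
    \<open>exp (2 * \<epsilon> * t)\<close> in the tail bound and leaves
    \<open>exp (- R) = \<epsilon> / \<phi>^2\<close>.\<close>
  define d where "d = nat \<lceil>6 * (\<epsilon> * real t + R)\<rceil>"
  define q where "q = negbin_poly t d"
  define B where "B = (\<Sum>k\<le>d. negbin_coeff t k)"
  have "ln 2 \<le> L" unfolding L_def using \<epsilon> by (subst ln_le_cancel_iff) (auto simp: field_simps)
  hence L: "L \<ge> 2 / 3" using ln2_ge_two_thirds by linarith
  have \<phi>2: "\<phi>^2 > 0" using \<phi> by simp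
  have sm: "200 * (\<epsilon> * L) \<le> \<phi>^2"
    using small1 \<phi>2 by (simp add: L_def field_simps)
  \<comment> \<open>The lower bound on \<open>L\<close> turns \<open>small1\<close> into a bound on
    \<open>\<epsilon> / \<phi>^2\<close> itself. The constant 3 suffices because it exceeds
    \<open>exp 1\<close>; the resulting \<open>R \<ge> 1\<close> absorbs the rounding in
    \<open>d\<close>.\<close>
  have "\<epsilon> * (2 / 3) \<le> \<epsilon> * L" using L \<epsilon> by (intro mult_left_mono) auto
  hence "3 * \<epsilon> \<le> \<phi>^2" using sm \<epsilon> by linarith
  hence "3 \<le> \<phi>^2 / \<epsilon>" using \<epsilon> by (simp add: field_simps)
  hence "exp 1 \<le> \<phi>^2 / \<epsilon>" using exp_le by linarith
  hence R: "R \<ge> 1" unfolding R_def using \<phi>2 \<epsilon> by (subst ln_ge_iff) auto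
  have et: "\<epsilon> * real t \<ge> 0" using \<epsilon> by simp
  have d1: "6 * (\<epsilon> * real t + R) \<le> real d" unfolding d_def by linarith
  have d2: "real d \<le> 6 * (\<epsilon> * real t) + 7 * R"
  proof -
    have "real d = of_int \<lceil>6 * (\<epsilon> * real t + R)\<rceil>" unfolding d_def using et R by simp
    also have "\<dots> \<le> 6 * (\<epsilon> * real t + R) + 1" by (rule of_int_ceiling_le_add_one)
    finally show ?thesis using R by argo
  qed
  have etL: "2 * \<epsilon> * real t \<le> 3 * (\<epsilon> * real t * L)"
    using mult_left_mono[OF L et] by simp
  have dL: "real d * L \<le> 6 * (\<epsilon> * real t * L) + 7 * (R * L)"
    using mult_right_mono[OF d2, of L] L by (simp add: algebra_simps)
  have B: "B \<le> exp (real d * L + 2 * \<epsilon> * real t)"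
    unfolding B_def L_def using \<epsilon> by (rule sum_negbin_coeff_le_exp)
  have B0: "B \<ge> 0" unfolding B_def by (intro sum_nonneg negbin_coeff_nonneg)
  have R_eps: "exp (- R) = \<epsilon> / \<phi>^2" unfolding R_def using \<epsilon> \<phi>2 by (simp add: exp_minus)

  have deg: "real (degree q) \<le> 7 * (\<epsilon> * real t + R)"
  proof -
    have "real (degree q) \<le> real d" unfolding q_def using degree_negbin_poly by simp
    thus ?thesis using d2 et by argo
  qed

  have coeffs: "\<bar>coeff (monom 1 t * q) i\<bar> \<le> (1 / \<epsilon>) powr (17 * (\<epsilon> * real t + R))" for i
  proof -
    have "\<bar>coeff (monom 1 t * q) i\<bar> \<le> 2 ^ d * B"
      using abs_coeff_negbin_poly_le[of t d "i - t"] B0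
      by (simp add: coeff_monom_mult q_def B_def)
    also have "\<dots> \<le> exp (real d * L) * exp (real d * L + 2 * \<epsilon> * real t)"
    proof (intro mult_mono B)
      have "(2::real) \<le> exp L" using \<epsilon> by (simp add: L_def field_simps)
      hence "(2::real) ^ d \<le> exp L ^ d" by (intro power_mono) auto
      thus "(2::real) ^ d \<le> exp (real d * L)" by (simp add: exp_of_nat_mult)
    qed (use B0 in auto)
    \<comment> \<open>By \<open>dL\<close> and \<open>etL\<close> the exponent is at most
      \<open>15 * (\<epsilon> * t * L) + 14 * (R * L)\<close>, so 17 is a generous common
      constant.\<close>
    also have "\<dots> \<le> exp (17 * (\<epsilon> * real t + R) * L)"
    proof -
      have "R * L \<ge> 0" "\<epsilon> * real t * L \<ge> 0" using R L et by auto
      hence "real d * L + (real d * L + 2 * \<epsilon> * real t) \<le> 17 * (\<epsilon> * real t * L) + 17 * (R * L)"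
        using dL etL by linarith
      thus ?thesis by (simp add: algebra_simps flip: exp_add)
    qed
    also have "\<dots> = (1 / \<epsilon>) powr (17 * (\<epsilon> * real t + R))"
      using \<epsilon> by (simp add: powr_def L_def)
    finally show ?thesis .
  qed

  have near: "\<bar>poly (monom 1 t * q) x - 1\<bar> \<le> \<epsilon> / \<phi>^2" if x: "x \<in> {1 - \<epsilon>..1}" for x
  proof -
    define y where "y = 1 - x"
    have y: "0 \<le> y" "y \<le> 1 / 2" "y \<le> \<epsilon>" using x \<epsilon> by (auto simp: y_def)
    have px: "poly (monom 1 t * q) x = (1 - y) ^ t * (\<Sum>k\<le>d. negbin_coeff t k * y ^ k)"
      by (simp add: y_def q_def poly_negbin_poly poly_monom)
    have "(2 / 3 :: real) \<le> exp (- (1 / 3))" using exp_ge_add_one_self[of "- (1/3)"] by simp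
    hence "(2 / 3 :: real) ^ d \<le> exp (- (1 / 3)) ^ d" by (intro power_mono) auto
    hence e: "(2 / 3 :: real) ^ d \<le> exp (- (real d / 3))" by (simp flip: exp_of_nat_mult)
    have "y * real t \<le> \<epsilon> * real t" using y by (intro mult_right_mono) auto
    hence "exp (2 * y * real t) * (2 / 3) ^ d \<le> exp (2 * \<epsilon> * real t) * exp (- (real d / 3))"
      by (intro mult_mono e) auto
    also have "\<dots> \<le> exp (- R)" using d1 et R by (simp flip: exp_add)
    finally have "exp (2 * y * real t) * (2 / 3) ^ d \<le> \<epsilon> / \<phi>^2" by (simp add: R_eps)
    thus ?thesis
      using negbin_tail_bounds[OF y(1,2), of t d] unfolding px by linarith
  qed

  have far: "\<bar>poly (monom 1 t * q) x\<bar> \<le> real n powr (-4)" if x: "x \<in> {0..1 - \<phi>^2 / 4}" for x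
  proof -
    \<comment> \<open>If \<open>\<phi>^2 > 4\<close> the interval is empty, so no separate case is
      needed.\<close>
    have "0 \<le> x" "x \<le> 1 - \<phi>^2 / 4" using x by auto
    hence x01: "0 \<le> x" "x \<le> 1" using \<phi>2 by linarith+
    have "x \<le> exp (- (\<phi>^2 / 4))" using x exp_ge_add_one_self[of "- (\<phi>^2 / 4)"] by simp
    hence "x ^ t \<le> exp (- (\<phi>^2 / 4)) ^ t" using x01 by (intro power_mono) auto
    hence xt: "x ^ t \<le> exp (- (\<phi>^2 * real t / 4))"
      by (simp add: mult.commute flip: exp_of_nat_mult)
    have q0: "poly q x \<ge> 0" unfolding q_def poly_negbin_poly
      using x01 by (intro sum_nonneg mult_nonneg_nonneg negbin_coeff_nonneg) auto
    \<comment> \<open>Far from 1 no cancellation is used: powers of \<open>1 - x\<close> are simply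
      bounded by 1, and \<open>x ^ t\<close> must supply all the decay.\<close>
    have "poly q x \<le> B" unfolding q_def poly_negbin_poly B_def
      using x01 by (intro sum_mono mult_left_le negbin_coeff_nonneg power_le_one) auto
    hence qB: "poly q x \<le> exp (real d * L + 2 * \<epsilon> * real t)" using B by linarith
    have "\<bar>poly (monom 1 t * q) x\<bar> = x ^ t * poly q x"
      using x01 q0 by (simp add: poly_monom)
    also have "\<dots> \<le> exp (- (\<phi>^2 * real t / 4)) * exp (real d * L + 2 * \<epsilon> * real t)"
      using xt qB q0 by (intro mult_mono) auto
    also have "\<dots> \<le> exp (- 4 * ln (real n))"
    \<comment> \<open>The exponent is at most
      \<open>- (1/4 - 9/200) * \<phi>^2 * t + 7/200 * ln n\<close>. With
      \<open>\<phi>^2 * t \<ge> 20 * ln n\<close> this is at most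
      \<open>- (4.1 - 0.035) * ln n\<close>, which explains the constants 20 and 1/200.\<close>
    proof -
      have a: "20 * ln (real n) \<le> \<phi>^2 * real t" using t \<phi>2 by (simp add: field_simps)
      have b: "200 * (\<epsilon> * real t * L) \<le> \<phi>^2 * real t"
        using mult_right_mono[OF sm, of "real t"] by (simp add: algebra_simps)
      have c: "R * L \<le> 1 / 200 * ln (real n)"
        using small2 by (simp add: L_def R_def mult.commute)
      have "ln (real n) \<ge> 0" using n by simp
      hence "- (\<phi>^2 * real t / 4) + (real d * L + 2 * \<epsilon> * real t) \<le> - 4 * ln (real n)"
        using a b c dL etL by argo
      thus ?thesis by (simp flip: exp_add)
    qed
    also have "\<dots> = real n powr (-4)" using n by (simp add: powr_def)
    finally show ?thesis .
  qed

  show ?thesis using deg coeffs near far unfolding R_def by blast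
qed

theorem mainTheorem3:
  "\<exists>c1 c2 K1 K2 :: real. c1 > 0 \<and> c2 > 0 \<and> K1 > 0 \<and> K2 > 0 \<and>
     (\<forall>(n::nat) (\<epsilon>::real) (\<phi>::real).
        n \<ge> 2 \<longrightarrow> 0 < \<epsilon> \<longrightarrow> \<epsilon> \<le> 1/2 \<longrightarrow> 0 < \<phi> \<longrightarrow>
        \<epsilon> / \<phi>^2 * ln (1/\<epsilon>) \<le> c1 \<longrightarrow>
        ln (1/\<epsilon>) * ln (\<phi>^2 / \<epsilon>) \<le> c2 * ln (real n) \<longrightarrow>
        (\<forall>t::nat. real t \<ge> 20 * (ln (real n) / \<phi>^2) \<longrightarrow>
           (\<exists>p q :: real poly.
              p = monom 1 t * q \<and>
              real (degree q) \<le> K1 * (\<epsilon> * real t + ln (\<phi>^2 / \<epsilon>)) \<and>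
              (\<forall>i. \<bar>coeff p i\<bar> \<le> (1/\<epsilon>) powr (K2 * (\<epsilon> * real t + ln (\<phi>^2 / \<epsilon>)))) \<and>
              (\<forall>x\<in>{1 - \<epsilon>..1}. \<bar>poly p x - 1\<bar> \<le> \<epsilon> / \<phi>^2) \<and>
              (\<forall>x\<in>{0..1 - \<phi>^2 / 4}. \<bar>poly p x\<bar> \<le> real n powr (-4)))))"
proof -
  have "(0::real) < 1 / 200" "(0::real) < 7" "(0::real) < 17" by auto
  thus ?thesis using exists_approx_poly by blast
qed

end
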